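(* Let $a,b,c,d$ be non-negative integers with $ad-bc=1$. Then there exists a unique pair of non-negative integers $(m,n)$ with $0\le m\le 2^n-1$ such that \[ U(2^n:m)=\begin{pmatrix} a&b\\ c&d\end{pmatrix}. \]
   Context: Stern's diatomic integers: for integers $n\ge0$, $0\le m\le 2^n$, define $[2^0:0]=0$, $[2^0:1]=1$, $[2^{n+1}:2m]=[2^n:m]$ ($0\le m\le 2^n$), $[2^{n+1}:2m+1]=[2^n:m]+[2^n:m+1]$ ($0\le m\le 2^n-1$). For $0\le m\le 2^n-1$, the Stern's diatomic matrix is \[ U(2^n:m)=\begin{pmatrix}[2^n:m+1]&[2^n:m]\\ [2^n:2^n-(m+1)]&[2^n:2^n-m]\end{pmatrix}. \] *)

theory Defs
  imports "HOL-Analysis.Analysis"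
begin

text \<open>
  The integer \<open>[2^n : m]\<close> is \<open>stern n m\<close>; it is meaningful only for \<open>m \<le> 2 ^ n\<close>.
  Outside this range the values are an artefact of totality.
\<close>

primrec stern :: "nat \<Rightarrow> nat \<Rightarrow> int" where
  "stern 0 m = (if m = 1 then 1 else 0)"
| "stern (Suc n) m =
    (if even m then stern n (m div 2) else stern n (m div 2) + stern n (m div 2 + 1))"

lemma stern_0_0: "stern 0 0 = 0"
  by simp

lemma stern_0_1: "stern 0 1 = 1"
  by simp

lemma stern_Suc_even: "stern (n + 1) (2 * m) = stern n m"
  by simp

lemma stern_Suc_odd: "stern (n + 1) (2 * m + 1) = stern n m + stern n (m + 1)"
  by simp

text \<open>
  The matrix \<open>U(2^n : m)\<close>, for \<open>m \<le> 2 ^ n - 1\<close>; in this range the subtractions on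
  natural numbers do not truncate.
\<close>

definition stern_matrix :: "nat \<Rightarrow> nat \<Rightarrow> int ^ 2 ^ 2" where
  "stern_matrix n m =
    vector [vector [stern n (m + 1), stern n m],
            vector [stern n (2 ^ n - (m + 1)), stern n (2 ^ n - m)]]"

end

theory Submission
  imports Defs
begin

text \<open>
  Refining \<open>n\<close> to \<open>n + 1\<close> replaces the matrix with columns \<open>x, y\<close> by one of the two
  matrices with columns \<open>x + y, y\<close> (even child \<open>2 m\<close>) and \<open>x, x + y\<close> (odd child \<open>2 m + 1\<close>).
  So the matrices \<open>U(2^n : m)\<close> form a binary tree rooted at the identity.  Conversely, in a
  non-negative matrix of determinant \<open>1\<close> other than the identity one column dominates the
  other entrywise; subtracting it is a step towards the root that decreases the entry sum, and the
  determinant determines which step it was.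
\<close>

text \<open>A plain quadruple, read row by row, so that equations between matrices split into
  equations between entries.\<close>

definition stern_entries :: "nat \<Rightarrow> nat \<Rightarrow> int \<times> int \<times> int \<times> int" where
  "stern_entries n m = (stern n (m + 1), stern n m, stern n (2 ^ n - (m + 1)), stern n (2 ^ n - m))"

lemma stern_matrix_eq_iff:
  "stern_matrix n m = vector [vector [a, b], vector [c, d]] \<longleftrightarrow> stern_entries n m = (a, b, c, d)"
  by (auto simp: stern_matrix_def stern_entries_def vec_eq_iff forall_2)

lemma stern_entries_0: "stern_entries 0 0 = (1, 0, 0, 1)"
  by (simp add: stern_entries_def)

lemma stern_entries_even:
  assumes "m < 2 ^ n" and "stern_entries n m = (a, b, c, d)"
  shows "stern_entries (Suc n) (2 * m) = (a + b, b, c + d, d)"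
proof -
  \<comment> \<open>The bound on \<open>m\<close> keeps the natural subtractions from truncating;
    the right-hand sides expose the parities on which the recursion of \<open>stern\<close>
    branches.\<close>
  have eqs: "2 ^ Suc n - (2 * m + 1) = 2 * (2 ^ n - (m + 1)) + 1"
    "2 ^ Suc n - 2 * m = 2 * (2 ^ n - m)" "2 ^ n - (m + 1) + 1 = 2 ^ n - m"
    using assms(1) by auto
  have "stern (Suc n) (2 ^ Suc n - (2 * m + 1)) = c + d"
    "stern (Suc n) (2 ^ Suc n - 2 * m) = d"
    unfolding eqs(1,2) using assms(2) eqs(3)
    by (simp_all add: stern_entries_def del: power_Suc)
  then show ?thesis
    using assms(2) unfolding stern_entries_def by simp
qed

lemma stern_entries_odd:
  assumes "m < 2 ^ n" and "stern_entries n m = (a, b, c, d)"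
  shows "stern_entries (Suc n) (2 * m + 1) = (a, a + b, c, c + d)"
proof -
  have eqs: "2 ^ Suc n - (2 * m + 1 + 1) = 2 * (2 ^ n - (m + 1))"
    "2 ^ Suc n - (2 * m + 1) = 2 * (2 ^ n - (m + 1)) + 1" "2 ^ n - (m + 1) + 1 = 2 ^ n - m"
    using assms(1) by auto
  have "stern (Suc n) (2 ^ Suc n - (2 * m + 1 + 1)) = c"
    "stern (Suc n) (2 ^ Suc n - (2 * m + 1)) = c + d"
    unfolding eqs(1,2) using assms(2) eqs(3)
    by (simp_all add: stern_entries_def del: power_Suc)
  then show ?thesis
    using assms(2) unfolding stern_entries_def by simp
qed

lemma stern_entries_Suc_cases:
  assumes "m < 2 ^ Suc n"
  obtains (even) k a b c d where "k < 2 ^ n" "m = 2 * k" "stern_entries n k = (a, b, c, d)"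
      "stern_entries (Suc n) m = (a + b, b, c + d, d)"
    | (odd) k a b c d where "k < 2 ^ n" "m = 2 * k + 1" "stern_entries n k = (a, b, c, d)"
      "stern_entries (Suc n) m = (a, a + b, c, c + d)"
proof -
  obtain a b c d where k: "stern_entries n (m div 2) = (a, b, c, d)"
    using prod_cases4 by blast
  have lt: "m div 2 < 2 ^ n"
    using assms by simp
  have "m = 2 * (m div 2) \<or> m = 2 * (m div 2) + 1"
    by presburger
  then show ?thesis
    using stern_entries_even[OF lt k] stern_entries_odd[OF lt k] that lt k by metis
qed

text \<open>Adding one column to the other preserves both non-negativity and the determinant, so
  both pass from the identity down the tree.\<close>

lemma stern_entries_nonneg_det:
  assumes "m < 2 ^ n" and "stern_entries n m = (a, b, c, d)"
  shows "0 \<le> a \<and> 0 \<le> b \<and> 0 \<le> c \<and> 0 \<le> d \<and> a * d - b * c = 1"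
  using assms
proof (induction n arbitrary: m a b c d)
  case 0
  then show ?case by (auto simp: stern_entries_0)
next
  case (Suc n)
  from Suc.prems(1) show ?case
  proof (cases rule: stern_entries_Suc_cases)
    case (even k a' b' c' d')
    then show ?thesis
      using Suc.IH[OF even(1,3)] Suc.prems(2) by (auto simp: algebra_simps)
  next
    case (odd k a' b' c' d')
    then show ?thesis
      using Suc.IH[OF odd(1,3)] Suc.prems(2) by (auto simp: algebra_simps)
  qed
qed

text \<open>Undoing either column addition on the identity would leave a parent with an entry
  \<open>-1\<close>.\<close>

lemma stern_entries_Suc_not_identity:
  assumes "m < 2 ^ Suc n"
  shows "stern_entries (Suc n) m \<noteq> (1, 0, 0, 1)"
  using assms
proof (cases rule: stern_entries_Suc_cases)
  case (even k a b c d)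
  then show ?thesis using stern_entries_nonneg_det[OF even(1,3)] by auto
next
  case (odd k a b c d)
  then show ?thesis using stern_entries_nonneg_det[OF odd(1,3)] by auto
qed

text \<open>Only the root carries the identity, so equal matrices lie both at the root or both below
  it. Below it they are children of the same kind, and their parents agree by induction.\<close>

lemma stern_entries_inj:
  assumes "m < 2 ^ n" and "m' < 2 ^ n'" and "stern_entries n m = stern_entries n' m'"
  shows "m = m' \<and> n = n'"
  using assms
proof (induction n arbitrary: m m' n')
  case 0
  then show ?case
    using stern_entries_Suc_not_identity[of m'] by (cases n') (auto simp: stern_entries_0)
next
  case (Suc n)
  obtain l where n': "n' = Suc l"
    using Suc.prems stern_entries_Suc_not_identity[of m n]
    by (cases n') (auto simp: stern_entries_0)
  have m': "m' < 2 ^ Suc l"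
    using Suc.prems(2) n' by simp
  from Suc.prems(1) show ?case
  proof (cases rule: stern_entries_Suc_cases)
    case E: (even k a b c d)
    from m' show ?thesis
    proof (cases rule: stern_entries_Suc_cases)
      case (even k' a' b' c' d')
      then show ?thesis
        using E Suc.prems(3) n' Suc.IH[OF E(1) even(1)] by auto
    next
      case (odd k' a' b' c' d')
      \<comment> \<open>An even and an odd child coincide only if each column dominates the other.
        Comparing entries gives \<open>a + b' = 0\<close> and \<open>c + d' = 0\<close>, so the
        first column of the even child's parent vanishes, against determinant 1.\<close>
      have "a = 0" "c = 0"
        using E(4) odd(4) Suc.prems(3) n' stern_entries_nonneg_det[OF E(1,3)]
          stern_entries_nonneg_det[OF odd(1,3)] by auto
      then show ?thesis
        using stern_entries_nonneg_det[OF E(1,3)] by simp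
    qed
  next
    case O: (odd k a b c d)
    from m' show ?thesis
    proof (cases rule: stern_entries_Suc_cases)
      case (even k' a' b' c' d')
      have "a' = 0" "c' = 0"
        using O(4) even(4) Suc.prems(3) n' stern_entries_nonneg_det[OF O(1,3)]
          stern_entries_nonneg_det[OF even(1,3)] by auto
      then show ?thesis
        using stern_entries_nonneg_det[OF even(1,3)] by simp
    next
      case (odd k' a' b' c' d')
      then show ?thesis
        using O Suc.prems(3) n' Suc.IH[OF O(1) odd(1)] by auto
    qed
  qed
qed

lemma nonneg_det_1_cases:
  fixes a b c d :: int
  assumes "0 \<le> a" "0 \<le> b" "0 \<le> c" "0 \<le> d" and det: "a * d - b * c = 1"
  obtains (identity) "a = 1" "b = 0" "c = 0" "d = 1"
    | (left) "b \<le> a" "d \<le> c" | (right) "a \<le> b" "c \<le> d"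
proof -
  \<comment> \<open>If neither column dominates, the two rows compare strictly in opposite
    directions.\<close>
  consider "b \<le> a" "d \<le> c" | "a \<le> b" "c \<le> d" | "b < a" "c < d" | "a < b" "d < c"
    by linarith
  then show thesis
  proof cases
    case 3
    \<comment> \<open>Over the integers \<open>b + 1 \<le> a\<close> and
      \<open>c + 1 \<le> d\<close>; with \<open>a * d = b * c + 1\<close> this leaves
      \<open>b + c \<le> 0\<close>.\<close>
    have "(b + 1) * (c + 1) \<le> a * d"
      using 3 assms by (intro mult_mono) auto
    then have "b = 0" "c = 0"
      using assms by (auto simp: algebra_simps)
    moreover from this have "a = 1" "d = 1"
      using assms by (auto simp: zmult_eq_1_iff)
    ultimately show ?thesis using identity by simp
  next
    case 4
    have "a * d \<le> b * c"
      using 4 assms by (intro mult_mono) auto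
    then show ?thesis using det by simp
  qed (use left right in auto)
qed

lemma stern_entries_surj:
  fixes a b c d :: int
  assumes "0 \<le> a" "0 \<le> b" "0 \<le> c" "0 \<le> d" "a * d - b * c = 1"
  shows "\<exists>n m. m < 2 ^ n \<and> stern_entries n m = (a, b, c, d)"
  using assms
proof (induction "nat (a + b + c + d)" arbitrary: a b c d rule: less_induct)
  case less
  from less.prems show ?case
  proof (cases rule: nonneg_det_1_cases)
    case identity
    have "0 < (2::nat) ^ 0 \<and> stern_entries 0 0 = (a, b, c, d)"
      using identity by (simp add: stern_entries_0)
    then show ?thesis by blast
  next
    case left
    \<comment> \<open>A zero second column would make the determinant 0; hence subtracting it
      strictly lowers the entry sum.\<close>
    have "b \<noteq> 0 \<or> d \<noteq> 0"
      using less.prems by auto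
    then have "\<exists>n m. m < 2 ^ n \<and> stern_entries n m = (a - b, b, c - d, d)"
      using left less.prems by (intro less.hyps) (auto simp: algebra_simps)
    then obtain n m where nm: "m < 2 ^ n" "stern_entries n m = (a - b, b, c - d, d)"
      by blast
    then have "2 * m < 2 ^ Suc n \<and> stern_entries (Suc n) (2 * m) = (a, b, c, d)"
      using stern_entries_even[OF nm] by simp
    then show ?thesis by blast
  next
    case right
    have "a \<noteq> 0 \<or> c \<noteq> 0"
      using less.prems by auto
    then have "\<exists>n m. m < 2 ^ n \<and> stern_entries n m = (a, b - a, c, d - c)"
      using right less.prems by (intro less.hyps) (auto simp: algebra_simps)
    then obtain n m where nm: "m < 2 ^ n" "stern_entries n m = (a, b - a, c, d - c)"
      by blast
    then have "2 * m + 1 < 2 ^ Suc n \<and> stern_entries (Suc n) (2 * m + 1) = (a, b, c, d)"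
      using stern_entries_odd[OF nm] by simp
    then show ?thesis by blast
  qed
qed

theorem theorem5p4:
  fixes a b c d :: int
  assumes "0 \<le> a" and "0 \<le> b" and "0 \<le> c" and "0 \<le> d"
    and "a * d - b * c = 1"
  shows "\<exists>!(m :: nat, n :: nat). m \<le> 2 ^ n - 1 \<and>
           stern_matrix n m = vector [vector [a, b], vector [c, d]]"
proof -
  \<comment> \<open>As \<open>2 ^ n\<close> is positive, \<open>2 ^ n - 1\<close> is a genuine
    predecessor.\<close>
  have le_iff: "m \<le> 2 ^ n - 1 \<longleftrightarrow> m < 2 ^ n" for m n :: nat
    using zero_less_power[of "2::nat" n] by linarith
  obtain n m where nm: "m < 2 ^ n" "stern_entries n m = (a, b, c, d)"
    using stern_entries_surj[OF assms] by blast
  show ?thesis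
    unfolding le_iff stern_matrix_eq_iff
  proof (rule ex1I[of _ "(m, n)"])
    show "case (m, n) of (m, n) \<Rightarrow> m < 2 ^ n \<and> stern_entries n m = (a, b, c, d)"
      using nm by simp
  next
    fix p :: "nat \<times> nat"
    assume "case p of (m, n) \<Rightarrow> m < 2 ^ n \<and> stern_entries n m = (a, b, c, d)"
    then show "p = (m, n)"
      using nm stern_entries_inj[of "fst p" "snd p" m n] by (auto split: prod.splits)
  qed
qed

end
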